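(* There exist a bounded, measurable and strictly accretive function $a : (-\infty,0)\times\mathbb{R}\to\mathbb{C}$ and a solution $u$ of $$\partial_t u-\partial_x\bigl(a(t,x)\,\partial_x u\bigr)=0 \quad\text{in } (-\infty,0)\times\mathbb{R}$$ such that $\|u\|_{\mathrm{L}^\infty(Q_1(0,0))}=\infty$.
   Context: Functions are complex-valued. A function $a$ is strictly accretive if there is a constant $\lambda>0$ such that $\operatorname{Re}(a)\ge\lambda$ almost everywhere on its domain. For $r>0$ and $(t_0,x_0)\in\mathbb{R}^2$, the backward-in-time parabolic cylinder is $Q_r(t_0,x_0):=(t_0-r^2,t_0)\times(x_0-r,x_0+r)$. A solution $u$ of the equation in $Q_r(t_0,x_0)$ is a function $u\in \mathrm{L}^2(Q_r(t_0,x_0))$ such that the distributional derivative $\partial_x u$ belongs to $\mathrm{L}^2(Q_r(t_0,x_0))$ and the equation $\partial_t u-\partial_x(a\,\partial_x u)=0$ holds in $Q_r(t_0,x_0)$ in the sense of distributions. A solution in $(-\infty,0)\times\mathbb{R}$ is a function that is a solution in every cylinder $Q_r(t_0,x_0)$ contained in $(-\infty,0)\times\mathbb{R}$ (this includes the cylinders $Q_r(0,x_0)$). The statement $\|u\|_{\mathrm{L}^\infty(Q_1(0,0))}=\infty$ means that $u$ is not essentially bounded on $Q_1(0,0)$. *)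

theory Defs
  imports "HOL-Analysis.Analysis"
begin

text \<open>
  Points of space-time are pairs \<open>z = (t, x)\<close>. Functions on a subset \<open>\<Omega>\<close> of the plane are
  represented by total functions, whose values outside \<open>\<Omega>\<close> are never used. Measurability and
  almost everywhere refer to Lebesgue measure.
\<close>

definition past_halfplane :: "(real \<times> real) set" where
  "past_halfplane = {..<0} \<times> UNIV"

definition parabolic_cylinder :: "real \<Rightarrow> real \<times> real \<Rightarrow> (real \<times> real) set" where
  "parabolic_cylinder r z = {fst z - r\<^sup>2<..<fst z} \<times> {snd z - r<..<snd z + r}"

definition strictly_accretive_on :: "(real \<times> real) set \<Rightarrow> (real \<times> real \<Rightarrow> complex) \<Rightarrow> bool" where
  "strictly_accretive_on \<Omega> a \<longleftrightarrow> (\<exists>c>0. AE z in lebesgue. z \<in> \<Omega> \<longrightarrow> Re (a z) \<ge> c)"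

definition essentially_bounded_on :: "(real \<times> real) set \<Rightarrow> (real \<times> real \<Rightarrow> complex) \<Rightarrow> bool" where
  "essentially_bounded_on \<Omega> u \<longleftrightarrow> (\<exists>C. AE z in lebesgue. z \<in> \<Omega> \<longrightarrow> cmod (u z) \<le> C)"

definition L2_on :: "(real \<times> real) set \<Rightarrow> (real \<times> real \<Rightarrow> complex) \<Rightarrow> bool" where
  "L2_on \<Omega> f \<longleftrightarrow> set_borel_measurable lebesgue \<Omega> f \<and>
     set_integrable lebesgue \<Omega> (\<lambda>z. (cmod (f z))\<^sup>2)"

definition dir_deriv ::
  "real \<times> real \<Rightarrow> (real \<times> real \<Rightarrow> complex) \<Rightarrow> real \<times> real \<Rightarrow> complex" where
  "dir_deriv v \<phi> z = frechet_derivative \<phi> (at z) v"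

abbreviation "e_t \<equiv> (1, 0) :: real \<times> real"
abbreviation "e_x \<equiv> (0, 1) :: real \<times> real"

primrec is_Ck :: "nat \<Rightarrow> (real \<times> real \<Rightarrow> complex) \<Rightarrow> bool" where
  "is_Ck 0 \<phi> \<longleftrightarrow> continuous_on UNIV \<phi>"
| "is_Ck (Suc k) \<phi> \<longleftrightarrow> (\<forall>z. \<phi> differentiable (at z)) \<and> (\<forall>v. is_Ck k (dir_deriv v \<phi>))"

definition test_functions :: "(real \<times> real) set \<Rightarrow> (real \<times> real \<Rightarrow> complex) set" where
  "test_functions \<Omega> = {\<phi>. (\<forall>k. is_Ck k \<phi>) \<and>
     compact (closure {z. \<phi> z \<noteq> 0}) \<and> closure {z. \<phi> z \<noteq> 0} \<subseteq> \<Omega>}"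

text \<open>
  Distributions on \<open>\<Omega>\<close> are only ever evaluated on \<open>test_functions \<Omega>\<close>. The pairing of a function
  with a test function is bilinear (no complex conjugation).
\<close>

definition dist_of ::
  "(real \<times> real) set \<Rightarrow> (real \<times> real \<Rightarrow> complex) \<Rightarrow> (real \<times> real \<Rightarrow> complex) \<Rightarrow> complex" where
  "dist_of \<Omega> f \<phi> = set_lebesgue_integral lebesgue \<Omega> (\<lambda>z. f z * \<phi> z)"

definition dist_deriv ::
  "real \<times> real \<Rightarrow> ((real \<times> real \<Rightarrow> complex) \<Rightarrow> complex) \<Rightarrow> (real \<times> real \<Rightarrow> complex) \<Rightarrow> complex" where
  "dist_deriv v T \<phi> = - T (dir_deriv v \<phi>)"

text \<open>
  In the next definition \<open>g\<close> is the distributional derivative of \<open>u\<close> in \<open>x\<close>; it is determined by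
  \<open>u\<close> almost everywhere on \<open>\<Omega>\<close>.
\<close>

definition parabolic_solution_on ::
  "(real \<times> real \<Rightarrow> complex) \<Rightarrow> (real \<times> real) set \<Rightarrow> (real \<times> real \<Rightarrow> complex) \<Rightarrow> bool" where
  "parabolic_solution_on a \<Omega> u \<longleftrightarrow> L2_on \<Omega> u \<and>
     (\<exists>g. L2_on \<Omega> g \<and>
       (\<forall>\<phi>\<in>test_functions \<Omega>. dist_deriv e_x (dist_of \<Omega> u) \<phi> = dist_of \<Omega> g \<phi>) \<and>
       (\<forall>\<phi>\<in>test_functions \<Omega>.
          dist_deriv e_t (dist_of \<Omega> u) \<phi> - dist_deriv e_x (dist_of \<Omega> (\<lambda>z. a z * g z)) \<phi> = 0))"

definition parabolic_solution_past ::
  "(real \<times> real \<Rightarrow> complex) \<Rightarrow> (real \<times> real \<Rightarrow> complex) \<Rightarrow> bool" where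
  "parabolic_solution_past a u \<longleftrightarrow>
     (\<forall>r>0. \<forall>z. parabolic_cylinder r z \<subseteq> past_halfplane \<longrightarrow>
        parabolic_solution_on a (parabolic_cylinder r z) u)"

end

theory Submission
  imports Defs
begin

text \<open>
  The solution is \<open>u = - ln P + C(\<sigma>)\<close> with \<open>P = x\<^sup>2 - t\<close> and the parabolically homogeneous variable
  \<open>\<sigma> = x\<^sup>2 / P \<in> [0, 1]\<close>. If the flux \<open>a u\<^sub>x\<close> is sought in the form \<open>x E(\<sigma>) / P\<close>, the
  equation \<open>u\<^sub>t = (a u\<^sub>x)\<^sub>x\<close> becomes \<open>1 + \<sigma> C' = E - 2 \<sigma> E + 2 \<sigma> (1 - \<sigma>) E'\<close>, which for every
  polynomial \<open>E\<close> with \<open>E(0) = 1\<close> has a polynomial solution \<open>C\<close>. Since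
  \<open>u\<^sub>x = - (2 x / P) (1 - (1 - \<sigma>) C')\<close>, the coefficient has to be
  \<open>a = - E / (2 (1 - (1 - \<sigma>) C'))\<close>, a function of \<open>\<sigma>\<close> alone. Real \<open>E\<close> cannot make it positive on
  \<open>[0, 1]\<close>, but a complex quadratic \<open>E\<close> can make its real part positive. The singularity at the
  origin is logarithmic, and \<open>u\<^sub>x\<close> is at most of size \<open>P powr (-1/2)\<close>, which is square integrable.
\<close>

section \<open>Distributional derivatives of continuously differentiable functions\<close>

text \<open>
  The difference quotients of \<open>F\<close> have integral zero by translation invariance and converge dominatedly.
\<close>

lemma integral_directional_derivative_eq_0:
  fixes F :: "'a::euclidean_space \<Rightarrow> complex"
  assumes der: "\<And>z. (F has_derivative F' z) (at z)"
    and cont: "continuous_on UNIV (\<lambda>z. F' z v)"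
    and K: "compact K" "\<And>z. z \<notin> K \<Longrightarrow> F z = 0"
  shows "integral\<^sup>L lborel (\<lambda>z. F' z v) = 0"
proof -
  have cF: "continuous_on UNIV F"
    using der
    by (meson differentiableI differentiable_at_withinI differentiable_imp_continuous_on differentiable_on_def)
  have F'0: "F' z v = 0" if "z \<notin> K" for z
  proof -
    have "(F has_derivative (\<lambda>_. 0)) (at z)"
    proof (rule has_derivative_transform_within_open[of "\<lambda>_. 0"])
      show "open (- K)" using K(1) by (simp add: compact_imp_closed open_Compl)
    qed (use that K(2) in auto)
    then show ?thesis using der[of z] has_derivative_unique by metis
  qed
  have "compact ((\<lambda>z. F' z v) ` K)"
    by (rule compact_continuous_image) (use continuous_on_subset[OF cont subset_UNIV] K in auto)
  then obtain B where B: "\<And>z. z \<in> K \<Longrightarrow> norm (F' z v) \<le> B" and B0: "B > 0"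
    using compact_imp_bounded bounded_pos by (metis image_eqI)
  have B': "norm (F' z v) \<le> B" for z
    using B F'0[of z] B0 by (cases "z \<in> K") auto
  obtain R where R: "\<And>z. z \<in> K \<Longrightarrow> norm z \<le> R"
    using K(1) compact_imp_bounded bounded_iff by metis
  define q where "q n z = (F (z + (1 / real (Suc n)) *\<^sub>R v) - F z) * of_nat (Suc n)" for n z
  have line: "((\<lambda>\<tau>. F (z + \<tau> *\<^sub>R v)) has_vector_derivative F' (z + \<tau> *\<^sub>R v) v) (at \<tau> within S)"
    for z \<tau> and S
  proof -
    have l: "linear (F' (z + \<tau> *\<^sub>R v))" using der has_derivative_linear by blast
    have "((\<lambda>\<tau>. F (z + \<tau> *\<^sub>R v)) has_derivative (\<lambda>h. F' (z + \<tau> *\<^sub>R v) (h *\<^sub>R v))) (at \<tau> within S)"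
      by (rule has_derivative_compose[OF _ der]) (auto intro!: derivative_eq_intros)
    then show ?thesis
      by (simp add: has_vector_derivative_def linear_scale[OF l])
  qed
  \<comment> \<open>The mean value inequality along the line through z in direction v gives a bound
    independent of n.\<close>
  have qB: "norm (q n z) \<le> B" for n z
  proof -
    have "norm (F (z + (1 / real (Suc n)) *\<^sub>R v) - F (z + 0 *\<^sub>R v)) \<le> B * norm (1 / real (Suc n) - 0)"
    proof (rule differentiable_bound[where S=UNIV and f = "\<lambda>\<tau>. F (z + \<tau> *\<^sub>R v)"])
      show "((\<lambda>\<tau>. F (z + \<tau> *\<^sub>R v)) has_derivative (\<lambda>h. h *\<^sub>R F' (z + x *\<^sub>R v) v)) (at x within UNIV)" for x
        using line[of z x UNIV] by (simp add: has_vector_derivative_def)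
      show "onorm (\<lambda>h. h *\<^sub>R F' (z + x *\<^sub>R v) v) \<le> B" for x
        by (rule onorm_le) (use B' in \<open>simp add: mult.commute[of B] mult_left_mono\<close>)
    qed auto
    then have "norm (F (z + (1 / real (Suc n)) *\<^sub>R v) - F z) * real (Suc n) \<le> B"
      by (simp add: field_simps del: of_nat_Suc)
    then show ?thesis by (simp add: q_def norm_mult del: of_nat_Suc)
  qed
  \<comment> \<open>The step \<open>1 / real (Suc n)\<close> is at most 1, so both evaluation points
    of the difference quotient lie outside K. The dominating function can thus be B on a fixed
    ball.\<close>
  have q0: "q n z = 0" if "norm z > R + norm v" for n z
  proof -
    have "norm ((1 / real (Suc n)) *\<^sub>R v) \<le> norm v"
      by (simp add: divide_le_eq mult_le_cancel_left1)
    moreover have "norm z \<le> norm (z + (1 / real (Suc n)) *\<^sub>R v) + norm ((1 / real (Suc n)) *\<^sub>R v)"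
      using norm_triangle_ineq4[of "z + (1 / real (Suc n)) *\<^sub>R v" "(1 / real (Suc n)) *\<^sub>R v"] by simp
    ultimately have "norm (z + (1 / real (Suc n)) *\<^sub>R v) > R" using that by linarith
    moreover have "norm z > R" using that by (smt (verit) norm_ge_zero)
    ultimately show ?thesis using K(2) R unfolding q_def by (smt (verit) diff_self mult_zero_left)
  qed
  have lim: "(\<lambda>n. q n z) \<longlonglongrightarrow> F' z v" for z
  proof -
    have "((\<lambda>\<tau>. F (z + \<tau> *\<^sub>R v)) has_vector_derivative F' z v) (at 0)"
      using line[of z 0 UNIV] by simp
    then have "((\<lambda>h. norm (F (z + h *\<^sub>R v) - F z - h *\<^sub>R F' z v) / norm h) \<longlongrightarrow> 0) (at 0)"
      by (simp add: has_vector_derivative_def has_derivative_at)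
    then have "((\<lambda>h. norm ((F (z + h *\<^sub>R v) - F z) /\<^sub>R h - F' z v)) \<longlongrightarrow> 0) (at 0)"
    proof (rule Lim_transform_eventually)
      have quot: "norm (w - h *\<^sub>R D) / norm h = norm (w /\<^sub>R h - D)" if "h \<noteq> 0" for w D :: complex and h :: real
      proof -
        have "w /\<^sub>R h - D = (w - h *\<^sub>R D) /\<^sub>R h" using that by (simp add: scaleR_diff_right)
        then show ?thesis by (simp add: divide_inverse mult.commute)
      qed
      show "\<forall>\<^sub>F h in at 0. norm (F (z + h *\<^sub>R v) - F z - h *\<^sub>R F' z v) / norm h
          = norm ((F (z + h *\<^sub>R v) - F z) /\<^sub>R h - F' z v)"
        unfolding eventually_at_filter by (intro always_eventually allI impI quot)
    qed
    from tendsto_norm_zero_cancel[OF this]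
    have *: "((\<lambda>h. (F (z + h *\<^sub>R v) - F z) /\<^sub>R h) \<longlongrightarrow> F' z v) (at 0)"
      by (rule Lim_null[THEN iffD2])
    have "filterlim (\<lambda>n. 1 / real (Suc n)) (at 0) sequentially"
      using LIMSEQ_Suc[OF lim_1_over_n] by (auto simp: filterlim_at simp del: of_nat_Suc)
    from filterlim_compose[OF * this]
    have "(\<lambda>n. (F (z + (1 / real (Suc n)) *\<^sub>R v) - F z) /\<^sub>R (1 / real (Suc n))) \<longlonglongrightarrow> F' z v" .
    then show ?thesis
      by (simp add: q_def scaleR_conv_of_real mult.commute del: of_nat_Suc)
  qed
  have iF: "integrable lborel F"
  proof -
    have "integrable lborel (\<lambda>z. indicator K z *\<^sub>R F z)"
      using borel_integrable_compact[OF K(1), of F] continuous_on_subset[OF cF]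
      by (simp add: indicator_scaleR_eq_if)
    moreover have "(\<lambda>z. indicator K z *\<^sub>R F z) = F" using K(2) by (auto simp: indicator_def fun_eq_iff)
    ultimately show ?thesis by simp
  qed
  have mF: "F \<in> borel_measurable borel" using cF by (rule borel_measurable_continuous_onI)
  have shift: "integrable lborel (\<lambda>z. F (z + c))" "integral\<^sup>L lborel (\<lambda>z. F (z + c)) = integral\<^sup>L lborel F" for c
  proof -
    have d: "lborel = distr lborel borel ((+) c)" by (simp add: lborel_distr_plus)
    show "integrable lborel (\<lambda>z. F (z + c))"
      using iF by (subst (asm) d, subst (asm) integrable_distr_eq) (auto simp: mF add.commute)
    show "integral\<^sup>L lborel (\<lambda>z. F (z + c)) = integral\<^sup>L lborel F"
      by (subst (2) d, subst integral_distr) (auto simp: mF add.commute)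
  qed
  have int0: "integral\<^sup>L lborel (q n) = 0" for n
    unfolding q_def using shift iF by simp
  have "(\<lambda>n. integral\<^sup>L lborel (q n)) \<longlonglongrightarrow> integral\<^sup>L lborel (\<lambda>z. F' z v)"
  proof (rule integral_dominated_convergence)
    show "integrable lborel (\<lambda>z. B * indicator (cball 0 (R + norm v)) z)"
      by (intro integrable_mult_right integrable_real_indicator) (use emeasure_lborel_cball_finite[of 0 "R + norm v"] in auto)
    show "AE z in lborel. (\<lambda>n. q n z) \<longlonglongrightarrow> F' z v" using lim by simp
    show "AE z in lborel. norm (q n z) \<le> B * indicator (cball 0 (R + norm v)) z" for n
      using qB q0 by (auto simp: indicator_def not_le)
    show "q n \<in> borel_measurable lborel" for n
      unfolding q_def using shift iF by (auto intro!: borel_measurable_times borel_measurable_diff)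
    show "(\<lambda>z. F' z v) \<in> borel_measurable lborel"
      using cont by (simp add: borel_measurable_continuous_onI)
  qed
  from LIMSEQ_unique[OF this[unfolded int0] tendsto_const] show ?thesis .
qed

text \<open>U and the complement of K form an open cover, and the product is continuous on the first
  set and zero on the second. No control of f outside U enters.\<close>

lemma continuous_on_mult_supported:
  fixes f \<psi> :: "'a::topological_space \<Rightarrow> complex"
  assumes "open U" "continuous_on U f" "continuous_on UNIV \<psi>"
    and "closed K" "K \<subseteq> U" "\<And>z. z \<notin> K \<Longrightarrow> \<psi> z = 0"
  shows "continuous_on UNIV (\<lambda>z. f z * \<psi> z)"
proof -
  have "continuous_on U (\<lambda>z. f z * \<psi> z)"
    using assms by (auto intro!: continuous_intros intro: continuous_on_subset)
  moreover have "continuous_on (- K) (\<lambda>z. f z * \<psi> z)"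
    using assms(6) by (subst continuous_on_cong[OF refl, where g="\<lambda>_. 0"]) auto
  ultimately have "continuous_on (U \<union> - K) (\<lambda>z. f z * \<psi> z)"
    using assms(1,4) by (intro continuous_on_open_Un) auto
  moreover have "U \<union> - K = UNIV" using assms(5) by auto
  ultimately show ?thesis by simp
qed

text \<open>Integration by parts: f times the test function, extended by zero, is differentiable
  with compact support, so its directional derivative integrates to zero. Since K is compact inside
  U, singularities of f on the boundary of U do no harm.\<close>

lemma dist_deriv_dist_of:
  assumes "open U" "\<Omega> \<subseteq> U"
    and f: "\<And>z. z \<in> U \<Longrightarrow> (f has_derivative f' z) (at z)"
    and f': "continuous_on U (\<lambda>z. f' z v)"
    and \<phi>: "\<phi> \<in> test_functions \<Omega>"
  shows "dist_deriv v (dist_of \<Omega> f) \<phi> = dist_of \<Omega> (\<lambda>z. f' z v) \<phi>"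
proof -
  define K where "K = closure {z. \<phi> z \<noteq> 0}"
  have K: "compact K" "closed K" "K \<subseteq> \<Omega>" "K \<subseteq> U"
    using \<phi> assms(2) by (auto simp: K_def test_functions_def)
  have \<phi>0: "\<phi> z = 0" if "z \<notin> K" for z
    using that closure_subset[of "{z. \<phi> z \<noteq> 0}"] by (auto simp: K_def)
  have Ck: "is_Ck (Suc 0) \<phi>" using \<phi> by (auto simp: test_functions_def simp del: is_Ck.simps)
  have d\<phi>: "(\<phi> has_derivative frechet_derivative \<phi> (at z)) (at z)" for z
    using Ck frechet_derivative_works[of \<phi> "at z"] by (cases z) simp
  have c\<phi>: "continuous_on UNIV \<phi>" using \<phi> unfolding test_functions_def by (auto dest!: spec[of _ 0])
  have cd\<phi>: "continuous_on UNIV (dir_deriv v \<phi>)" using Ck by (cases v) simp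
  have fd0: "frechet_derivative \<phi> (at z) = (\<lambda>_. 0)" if "z \<notin> K" for z
  proof -
    have "(\<phi> has_derivative (\<lambda>_. 0)) (at z)"
      by (rule has_derivative_transform_within_open[of "\<lambda>_. 0" _ _ _ "- K"])
        (use that \<phi>0 K in auto)
    then show ?thesis using d\<phi> has_derivative_unique by metis
  qed
  have d\<phi>0: "dir_deriv v \<phi> z = 0" if "z \<notin> K" for z
    using fd0[OF that] by (simp add: dir_deriv_def)
  have cf: "continuous_on U f"
    using f by (meson continuous_at_imp_continuous_on has_derivative_continuous)
  have c1: "continuous_on UNIV (\<lambda>z. f' z v * \<phi> z)"
    by (rule continuous_on_mult_supported[OF assms(1) f' c\<phi> K(2,4) \<phi>0])
  have c2: "continuous_on UNIV (\<lambda>z. f z * dir_deriv v \<phi> z)"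
    by (rule continuous_on_mult_supported[OF assms(1) cf cd\<phi> K(2,4) d\<phi>0])
  have int: "integrable lborel g" if "continuous_on UNIV g" "\<And>z. z \<notin> K \<Longrightarrow> g z = 0"
    for g :: "real \<times> real \<Rightarrow> complex"
  proof -
    have "integrable lborel (\<lambda>z. indicator K z *\<^sub>R g z)"
      using borel_integrable_compact[OF K(1), of g] continuous_on_subset[OF that(1)]
      by (simp add: indicator_scaleR_eq_if)
    moreover have "(\<lambda>z. indicator K z *\<^sub>R g z) = g" using that(2) by (auto simp: indicator_def fun_eq_iff)
    ultimately show ?thesis by simp
  qed
  \<comment> \<open>The integrand vanishes off K, so the integral extends to the whole plane, where
    translation invariance was used.\<close>
  have dist: "dist_of \<Omega> h \<psi> = integral\<^sup>L lborel (\<lambda>z. h z * \<psi> z)"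
    if "continuous_on UNIV (\<lambda>z. h z * \<psi> z)" "\<And>z. z \<notin> K \<Longrightarrow> \<psi> z = 0" for h \<psi>
  proof -
    have "(\<lambda>z. indicator \<Omega> z *\<^sub>R (h z * \<psi> z)) = (\<lambda>z. h z * \<psi> z)"
      using that(2) K(3) by (auto simp: indicator_def fun_eq_iff)
    then show ?thesis using that(1) unfolding dist_of_def set_lebesgue_integral_def
      by (simp add: integral_completion borel_measurable_continuous_onI)
  qed
  have "integral\<^sup>L lborel (\<lambda>z. f' z v * \<phi> z + f z * frechet_derivative \<phi> (at z) v) = 0"
  proof (rule integral_directional_derivative_eq_0[where F = "\<lambda>z. f z * \<phi> z"
          and F' = "\<lambda>z h. f' z h * \<phi> z + f z * frechet_derivative \<phi> (at z) h"])
    show "((\<lambda>z. f z * \<phi> z) has_derivative (\<lambda>h. f' z h * \<phi> z + f z * frechet_derivative \<phi> (at z) h)) (at z)" for z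
    \<comment> \<open>Off K the values of f and f' may be arbitrary, but they only occur multiplied
      by zero, in agreement with a product that vanishes near z.\<close>
    proof (cases "z \<in> K")
      case True
      then have "z \<in> U" using K by auto
      from has_derivative_mult[OF f[OF this] d\<phi>] show ?thesis by (simp add: add.commute)
    next
      case False
      have "((\<lambda>z. f z * \<phi> z) has_derivative (\<lambda>_. 0)) (at z)"
        by (rule has_derivative_transform_within_open[of "\<lambda>_. 0" _ _ _ "- K"])
          (use False \<phi>0 K in auto)
      then show ?thesis using False fd0 \<phi>0 by simp
    qed
    show "continuous_on UNIV (\<lambda>z. f' z v * \<phi> z + f z * frechet_derivative \<phi> (at z) v)"
      using continuous_on_add[OF c1 c2] by (simp add: dir_deriv_def)
  qed (use K \<phi>0 in auto)
  also have "integral\<^sup>L lborel (\<lambda>z. f' z v * \<phi> z + f z * frechet_derivative \<phi> (at z) v)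
      = integral\<^sup>L lborel (\<lambda>z. f' z v * \<phi> z) + integral\<^sup>L lborel (\<lambda>z. f z * dir_deriv v \<phi> z)"
    unfolding dir_deriv_def[symmetric]
    by (rule Bochner_Integration.integral_add) (use int[OF c1] int[OF c2] \<phi>0 d\<phi>0 in auto)
  finally show ?thesis
    unfolding dist_deriv_def by (simp add: dist[OF c1 \<phi>0] dist[OF c2 d\<phi>0] add_eq_0_iff)
qed

section \<open>The self-similar solution\<close>

text \<open>On the past half-plane this is x^2 + |t|, comparable to the square of the parabolic
  distance to the origin.\<close>

definition pdist :: "real \<times> real \<Rightarrow> real" where
  "pdist z = (snd z)\<^sup>2 - fst z"

definition simvar :: "real \<times> real \<Rightarrow> real" where
  "simvar z = (snd z)\<^sup>2 / pdist z"

text \<open>The polynomial C belonging to E = \<open>flux_profile\<close>, found by comparing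
  coefficients in the equation for C' and normalised by C(0) = 0.\<close>

definition corrector :: "complex \<Rightarrow> complex" where
  "corrector s = (4 - 12 * \<i>) * s + (-19 + 8 * \<i>) * s\<^sup>2 + 12 * s ^ 3"

definition corrector' :: "complex \<Rightarrow> complex" where
  "corrector' s = (4 - 12 * \<i>) + (-38 + 16 * \<i>) * s + 36 * s\<^sup>2"

definition slope_profile :: "complex \<Rightarrow> complex" where
  "slope_profile s = 1 - (1 - s) * corrector' s"

text \<open>
  The coefficients 2 - 4 \<open>\<i>\<close> and -6 were found by a numerical search for small integers that make
  the coefficient accretive.
\<close>

definition flux_profile :: "complex \<Rightarrow> complex" where
  "flux_profile s = 1 + (2 - 4 * \<i>) * s - 6 * s\<^sup>2"

definition coeff :: "real \<times> real \<Rightarrow> complex" where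
  "coeff z = - flux_profile (simvar z) / (2 * slope_profile (simvar z))"

definition sol :: "real \<times> real \<Rightarrow> complex" where
  "sol z = of_real (- ln (pdist z)) + corrector (simvar z)"

definition sol_x :: "real \<times> real \<Rightarrow> complex" where
  "sol_x z = of_real (- 2 * snd z / pdist z) * slope_profile (simvar z)"

definition sol_t :: "real \<times> real \<Rightarrow> complex" where
  "sol_t z = of_real (1 / pdist z) * (1 + of_real (simvar z) * corrector' (simvar z))"

definition flux :: "real \<times> real \<Rightarrow> complex" where
  "flux z = of_real (snd z / pdist z) * flux_profile (simvar z)"

lemma open_past_halfplane: "open past_halfplane"
  by (simp add: past_halfplane_def open_Times)

lemma pdist_pos: "z \<in> past_halfplane \<Longrightarrow> pdist z > 0"
  by (auto simp: past_halfplane_def pdist_def intro: add_nonneg_pos less_le_trans)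

lemma simvar_bounds:
  assumes "z \<in> past_halfplane"
  shows "0 \<le> simvar z" "simvar z \<le> 1"
  using pdist_pos[OF assms] assms by (auto simp: simvar_def pdist_def past_halfplane_def divide_le_eq)

section \<open>Derivatives of the solution and of the flux\<close>

lemma has_derivative_pdist: "(pdist has_derivative (\<lambda>h. 2 * snd z * snd h - fst h)) (at z)"
  unfolding pdist_def by (auto intro!: derivative_eq_intros)

text \<open>Quotient rule with \<open>x^2 / pdist z\<close> rewritten as \<open>simvar z\<close>; in
  this form later identities become polynomial in the similarity variable.\<close>

lemma has_derivative_simvar:
  assumes "z \<in> past_halfplane"
  shows "(simvar has_derivative (\<lambda>h. (2 * snd z * (1 - simvar z) * snd h + simvar z * fst h) / pdist z)) (at z)"
proof -
  have "pdist z \<noteq> 0" using pdist_pos[OF assms] by simp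
  then show ?thesis unfolding simvar_def
    by (auto intro!: derivative_eq_intros has_derivative_pdist ext simp: field_simps power2_eq_square)
qed

lemma has_derivative_compose_simvar:
  assumes z: "z \<in> past_halfplane" and f: "(f has_field_derivative D) (at (complex_of_real (simvar z)))"
  shows "((\<lambda>z. f (simvar z)) has_derivative
     (\<lambda>h. D * of_real ((2 * snd z * (1 - simvar z) * snd h + simvar z * fst h) / pdist z))) (at z)"
  by (rule has_derivative_compose[OF has_derivative_of_real[OF has_derivative_simvar[OF z]]
        f[unfolded has_field_derivative_def]])

lemma has_derivative_sol:
  assumes z: "z \<in> past_halfplane"
  shows "(sol has_derivative (\<lambda>h. of_real (fst h) * sol_t z + of_real (snd h) * sol_x z)) (at z)"
proof -
  have P: "pdist z > 0" using pdist_pos[OF z] .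
  have "(corrector has_field_derivative corrector' s) (at s)" for s
    unfolding corrector_def corrector'_def by (auto intro!: derivative_eq_intros simp: algebra_simps)
  note corrector = has_derivative_compose_simvar[OF z this]
  have ln: "((\<lambda>z. complex_of_real (- ln (pdist z))) has_derivative
      (\<lambda>h. of_real (- ((2 * snd z * snd h - fst h) / pdist z)))) (at z)"
    by (rule has_derivative_of_real has_derivative_minus)+
      (use P in \<open>auto intro!: derivative_eq_intros has_derivative_pdist simp: field_simps\<close>)
  from has_derivative_add[OF ln corrector] show ?thesis
    unfolding sol_def
    by (rule has_derivative_eq_rhs) (use P in \<open>simp add: sol_t_def sol_x_def slope_profile_def field_simps fun_eq_iff\<close>)
qed

text \<open>The second claim is the differential equation, pointwise. Only the x-derivative is
  needed in closed form, hence the \<open>frechet_derivative\<close> in the first claim.\<close>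

lemma has_derivative_flux:
  assumes z: "z \<in> past_halfplane"
  shows "(flux has_derivative frechet_derivative flux (at z)) (at z)"
    and "frechet_derivative flux (at z) e_x = sol_t z"
proof -
  define P where "P = pdist z"
  define s where "s = simvar z"
  define x where "x = snd z"
  have P: "P > 0" using pdist_pos[OF z] by (simp add: P_def)
  \<comment> \<open>Since x enters the x-derivative of the flux only through its square, this
    eliminates it and leaves 1/P times a polynomial in s.\<close>
  have x: "x\<^sup>2 = s * P" using P by (simp add: simvar_def x_def s_def P_def)
  have "(flux_profile has_field_derivative (2 - 4 * \<i>) - 12 * s) (at s)" for s
    unfolding flux_profile_def by (auto intro!: derivative_eq_intros simp: algebra_simps)
  note prof = has_derivative_compose_simvar[OF z this]
  have "((\<lambda>z. complex_of_real (snd z / pdist z)) has_derivative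
      (\<lambda>h. of_real ((snd h * P - x * (2 * x * snd h - fst h)) / P\<^sup>2))) (at z)"
    by (rule has_derivative_of_real)
      (use P in \<open>auto intro!: derivative_eq_intros has_derivative_pdist
         simp: field_simps P_def x_def power2_eq_square\<close>)
  note d = has_derivative_mult[OF this prof, folded flux_def P_def x_def s_def]
  have 1: "(1 * P - x * (2 * x * 1 - 0)) / P\<^sup>2 = (1 - 2 * s) / P"
  proof -
    have "1 * P - x * (2 * x * 1 - 0) = P - 2 * x\<^sup>2" by (simp add: power2_eq_square)
    also have "\<dots> = P * (1 - 2 * s)" unfolding x by (simp add: algebra_simps)
    finally show ?thesis using P by (simp add: power2_eq_square)
  qed
  have 2: "x / P * ((2 * x * (1 - s) * 1 + s * 0) / P) = 2 * s * (1 - s) / P"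
  proof -
    have "x / P * ((2 * x * (1 - s) * 1 + s * 0) / P) = 2 * x\<^sup>2 * (1 - s) / P\<^sup>2" by (simp add: power2_eq_square)
    then show ?thesis using P unfolding x by (simp add: power2_eq_square)
  qed
  have "complex_of_real (x / P) * (((2 - 4 * \<i>) - 12 * of_real s) * of_real ((2 * x * (1 - s) * 1 + s * 0) / P))
      + of_real ((1 * P - x * (2 * x * 1 - 0)) / P\<^sup>2) * flux_profile s
    = ((2 - 4 * \<i>) - 12 * of_real s) * of_real (x / P * ((2 * x * (1 - s) * 1 + s * 0) / P))
      + of_real ((1 * P - x * (2 * x * 1 - 0)) / P\<^sup>2) * flux_profile s"
    by (simp only: of_real_mult mult_ac)
  also have "\<dots> = of_real (1 / P) * (((2 - 4 * \<i>) - 12 * of_real s) * (2 * s * (1 - s)) + (1 - 2 * s) * flux_profile s)"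
    unfolding 1 2
    by (simp only: of_real_divide of_real_mult of_real_diff of_real_1 of_real_numeral divide_inverse)
      (simp add: algebra_simps)
  \<comment> \<open>The ordinary differential equation linking E and C, from which the coefficients
    of \<open>corrector\<close> were obtained.\<close>
  also have "((2 - 4 * \<i>) - 12 * of_real s) * (2 * s * (1 - s)) + (1 - 2 * s) * flux_profile s = 1 + s * corrector' s"
    unfolding flux_profile_def corrector'_def by (simp add: eval_nat_numeral algebra_simps)
  finally have eq: "complex_of_real (x / P) * (((2 - 4 * \<i>) - 12 * of_real s) * of_real ((2 * x * (1 - s) * snd e_x + s * fst e_x) / P))
      + of_real ((snd e_x * P - x * (2 * x * snd e_x - fst e_x)) / P\<^sup>2) * flux_profile s = sol_t z"
    unfolding sol_t_def fst_conv snd_conv by (simp add: P_def s_def)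
  show "(flux has_derivative frechet_derivative flux (at z)) (at z)"
    using d frechet_derivative_at[OF d] by simp
  show "frechet_derivative flux (at z) e_x = sol_t z"
    by (rule trans[OF fun_cong[OF frechet_derivative_at[OF d], symmetric] eq])
qed

text \<open>Multiplying numerator and denominator of \<open>coeff\<close> by the conjugate of the
  slope profile shows that its real part has the opposite sign to this quantity. The strict
  inequality also excludes zeros of the denominator.\<close>

lemma Re_flux_profile_cnj_slope_profile_neg:
  assumes "0 \<le> s" "s \<le> 1"
  shows "Re (flux_profile (of_real s) * cnj (slope_profile (of_real s))) < 0"
proof -
  have "Re (flux_profile (of_real s) * cnj (slope_profile (of_real s)))
     = - (3 + 12 * s - 140 * s ^ 2 + 428 * s ^ 3 - 516 * s ^ 4 + 216 * s ^ 5)"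
    by (simp add: flux_profile_def slope_profile_def corrector'_def eval_nat_numeral algebra_simps)
  moreover have "3 + 12 * s - 140 * s ^ 2 + 428 * s ^ 3 - 516 * s ^ 4 + 216 * s ^ 5 > 0"
  proof (cases "s \<le> 1 / 2")
    case True
    \<comment> \<open>Bernstein expansions on the two halves of the unit interval\<close>
    define a b where "a = 2 * s" and "b = 1 - 2 * s"
    have "3 + 12 * s - 140 * s ^ 2 + 428 * s ^ 3 - 516 * s ^ 4 + 216 * s ^ 5
      = 1 + (2 * b ^ 5 + 16 * (a * b ^ 4) + 9 * (a ^ 2 * b ^ 3) + 9 / 2 * (a ^ 3 * b ^ 2)
         + 15 / 4 * (a ^ 4 * b) + a ^ 5)" (is "_ = _ + ?R")
      unfolding a_def b_def by (simp add: eval_nat_numeral algebra_simps)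
    moreover have "a \<ge> 0" "b \<ge> 0" using assms True by (auto simp: a_def b_def)
    then have "?R \<ge> 0" by (intro add_nonneg_nonneg mult_nonneg_nonneg zero_le_power) auto
    ultimately show ?thesis by linarith
  next
    case False
    \<comment> \<open>In degree 5 the coefficient of a^4 b would be negative on this half; raising
      the degree to 6 by a + b = 1 makes all coefficients positive. The constant kept apart gives
      strictness.\<close>
    define a b where "a = 2 * s - 1" and "b = 2 - 2 * s"
    have "3 + 12 * s - 140 * s ^ 2 + 428 * s ^ 3 - 516 * s ^ 4 + 216 * s ^ 5
      = 1 / 4 + (7 / 4 * b ^ 6 + 47 / 4 * (a * b ^ 5) + 32 * (a ^ 2 * b ^ 4) + 75 / 2 * (a ^ 3 * b ^ 3)
         + 53 / 4 * (a ^ 4 * b ^ 2) + 1 / 2 * (a ^ 5 * b) + 11 / 4 * a ^ 6)" (is "_ = _ + ?R")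
      unfolding a_def b_def by (simp add: eval_nat_numeral algebra_simps)
    moreover have "a \<ge> 0" "b \<ge> 0" using assms False by (auto simp: a_def b_def)
    then have "?R \<ge> 0" by (intro add_nonneg_nonneg mult_nonneg_nonneg zero_le_power) auto
    ultimately show ?thesis by linarith
  qed
  ultimately show ?thesis by simp
qed


lemma slope_profile_nonzero: "0 \<le> s \<Longrightarrow> s \<le> 1 \<Longrightarrow> slope_profile (of_real s) \<noteq> 0"
  using Re_flux_profile_cnj_slope_profile_neg[of s] by auto

section \<open>Continuity and measurability of the explicit functions\<close>

lemma continuous_on_profiles [continuous_intros]:
  assumes "continuous_on A f"
  shows "continuous_on A (\<lambda>z. corrector (f z))" "continuous_on A (\<lambda>z. corrector' (f z))"
    "continuous_on A (\<lambda>z. slope_profile (f z))" "continuous_on A (\<lambda>z. flux_profile (f z))"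
  unfolding corrector_def corrector'_def slope_profile_def flux_profile_def using assms by (auto intro!: continuous_intros)

lemma continuous_on_pdist [continuous_intros]: "continuous_on A pdist"
  unfolding pdist_def by (intro continuous_intros)

lemma continuous_on_simvar [continuous_intros]: "continuous_on past_halfplane simvar"
  unfolding simvar_def using pdist_pos by (intro continuous_intros) force

lemma continuous_on_sol: "continuous_on past_halfplane sol"
  and continuous_on_sol_x: "continuous_on past_halfplane sol_x"
  and continuous_on_sol_t: "continuous_on past_halfplane sol_t"
  unfolding sol_def sol_x_def sol_t_def
  by (intro continuous_intros; use pdist_pos in force)+

text \<open>Measurability holds on the whole plane, because division with the default value 0 at a
  zero denominator is Borel.\<close>

lemma borel_measurable_profile:
  fixes f :: "complex \<Rightarrow> complex"
  assumes "continuous_on UNIV f"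
  shows "(\<lambda>z. f (simvar z)) \<in> borel_measurable borel"
proof -
  have "simvar \<in> borel_measurable borel"
    unfolding simvar_def using continuous_on_pdist
    by (intro borel_measurable_divide borel_measurable_continuous_onI continuous_intros)
  then have "(\<lambda>z. complex_of_real (simvar z)) \<in> borel_measurable borel" by measurable
  then show ?thesis using borel_measurable_continuous_onI[OF assms] by measurable
qed

lemma borel_measurable_pdist [measurable]: "pdist \<in> borel_measurable borel"
  by (intro borel_measurable_continuous_onI continuous_intros)

lemma borel_measurable_coeff: "coeff \<in> borel_measurable borel"
  and borel_measurable_sol: "sol \<in> borel_measurable borel"
  and borel_measurable_sol_x: "sol_x \<in> borel_measurable borel"
proof -
  have [measurable]: "(snd :: real \<times> real \<Rightarrow> real) \<in> borel_measurable borel"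
    by (intro borel_measurable_continuous_onI continuous_intros)
  have [measurable]: "(\<lambda>z. corrector (simvar z)) \<in> borel_measurable borel"
    "(\<lambda>z. slope_profile (simvar z)) \<in> borel_measurable borel"
    "(\<lambda>z. flux_profile (simvar z)) \<in> borel_measurable borel"
    by (intro borel_measurable_profile continuous_intros)+
  show "coeff \<in> borel_measurable borel" "sol \<in> borel_measurable borel" "sol_x \<in> borel_measurable borel"
    unfolding coeff_def sol_def sol_x_def by measurable
qed

section \<open>Square integrability up to the singularity\<close>

lemma integrable_abs_powr:
  fixes a M :: real
  assumes "a > -1" "M \<ge> 0"
  shows "integrable lborel (\<lambda>x. indicator {-M..M} x * \<bar>x\<bar> powr a)"
proof -
  define g where "g x = indicator {0..M} x *\<^sub>R (x powr a)" for x :: real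
  have "(\<lambda>x. x powr a) absolutely_integrable_on {0..M}"
    using assms by (intro nonnegative_absolutely_integrable_1 integrable_on_powr_from_0) auto
  then have "integrable lebesgue g" by (simp add: set_integrable_def g_def[abs_def])
  moreover have "g \<in> borel_measurable lborel" unfolding g_def by measurable
  ultimately have "integrable lborel g" using integrable_completion by blast
  then have "integrable lborel (\<lambda>x. g x + g (0 + (-1) * x))"
    by (intro Bochner_Integration.integrable_add lborel_integrable_real_affine) auto
  \<comment> \<open>The two halves overlap at x = 0, where both summands are zero because
    \<open>0 powr a = 0\<close>.\<close>
  moreover have "(\<lambda>x. g x + g (0 + (-1) * x)) = (\<lambda>x. indicator {-M..M} x * \<bar>x\<bar> powr a)"
    by (auto simp: g_def indicator_def fun_eq_iff abs_if)
  ultimately show ?thesis by simp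
qed

lemma integrable_lborel_prod_mult:
  fixes f g :: "real \<Rightarrow> real"
  assumes "integrable lborel f" "integrable lborel g"
  shows "integrable lborel (\<lambda>z. f (fst z) * g (snd z))"
proof -
  have [measurable]: "f \<in> borel_measurable borel" "g \<in> borel_measurable borel"
    using assms by auto
  have "integrable (lborel \<Otimes>\<^sub>M lborel) (\<lambda>z. f (fst z) * g (snd z))"
  proof (rule lborel_pair.Fubini_integrable)
    show "integrable lborel (\<lambda>x. \<integral>y. norm (f (fst (x, y)) * g (snd (x, y))) \<partial>lborel)"
      using assms by (simp add: abs_mult)
  qed (use assms in auto)
  then show ?thesis by (simp add: lborel_prod)
qed

text \<open>Write P = P^(3/4) P^(1/4) and use P >= |t| in the first factor and P >= x^2 in the
  second. The split leaves both exponents, -3/4 and -1/2, above -1, so the bound is a locally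
  integrable product. On the axis x = 0 it would fail, as \<open>powr\<close> is zero there.\<close>

lemma inverse_pdist_le:
  assumes "z \<in> past_halfplane" "snd z \<noteq> 0"
  shows "1 / pdist z \<le> \<bar>fst z\<bar> powr (-3/4) * \<bar>snd z\<bar> powr (-1/2)"
proof -
  have t: "fst z < 0" using assms by (auto simp: past_halfplane_def)
  have P: "pdist z > 0" using pdist_pos[OF assms(1)] .
  have "\<bar>snd z\<bar> powr (1/2) = ((snd z)\<^sup>2) powr (1/4)"
  proof -
    have "(snd z)\<^sup>2 = \<bar>snd z\<bar> powr 2" using assms by (simp add: powr_numeral)
    then show ?thesis by (simp only: powr_powr) simp
  qed
  also have "\<dots> \<le> pdist z powr (1/4)" using t by (intro powr_mono2) (auto simp: pdist_def)
  finally have "\<bar>fst z\<bar> powr (3/4) * \<bar>snd z\<bar> powr (1/2) \<le> pdist z powr (3/4) * pdist z powr (1/4)"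
    using t by (intro mult_mono powr_mono2) (auto simp: pdist_def)
  also have "\<dots> = pdist z" using P by (simp add: powr_add[symmetric])
  finally show ?thesis using P t assms(2)
    by (simp add: powr_minus field_simps)
qed

text \<open>The square of the assumed bound is c^2 (P + 1)^2 / P. On a cylinder P is bounded and 1/P
  has the integrable product majorant, even when the closure contains the origin.\<close>

lemma L2_on_parabolic_cylinder:
  assumes sub: "parabolic_cylinder r w \<subseteq> past_halfplane" and r: "r > 0"
    and f: "f \<in> borel_measurable borel"
    and bd: "\<And>z. z \<in> past_halfplane \<Longrightarrow> cmod (f z) \<le> c * (pdist z + 1) / sqrt (pdist z)"
  shows "L2_on (parabolic_cylinder r w) f"
proof -
  let ?Q = "parabolic_cylinder r w"
  \<comment> \<open>A crude bound for both |t| and |x| on the cylinder; it yields P <= M^2 + M,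
    whence the constant C below.\<close>
  define M where "M = \<bar>fst w\<bar> + \<bar>snd w\<bar> + r + r\<^sup>2"
  have M: "M \<ge> 0" using r by (simp add: M_def)
  have Q: "fst z \<in> {-M..M}" "snd z \<in> {-M..M}" "z \<in> past_halfplane" if "z \<in> ?Q" for z
  proof -
    have "fst z < 0" "z \<in> past_halfplane" using that sub by (auto simp: past_halfplane_def)
    moreover have "0 \<le> r\<^sup>2" by simp
    ultimately show "fst z \<in> {-M..M}" "snd z \<in> {-M..M}" "z \<in> past_halfplane"
      using that r unfolding M_def parabolic_cylinder_def by (auto simp: mem_Times_iff abs_if)
  qed
  have [measurable]: "?Q \<in> sets borel"
    by (intro borel_open) (simp add: parabolic_cylinder_def open_Times)
  define C where "C = c\<^sup>2 * (M\<^sup>2 + M + 1)\<^sup>2"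
  define g where "g z = C * ((indicator {-M..M} (fst z) * \<bar>fst z\<bar> powr (-3/4))
     * (indicator {-M..M} (snd z) * \<bar>snd z\<bar> powr (-1/2)))" for z
  have "integrable lborel g" unfolding g_def
    using M by (intro integrable_mult_right integrable_lborel_prod_mult integrable_abs_powr) auto
  then have g: "integrable lebesgue g"
    using integrable_completion[of g lborel] borel_measurable_integrable by blast
  \<comment> \<open>The axis x = 0, where the majorant degenerates, is a null set.\<close>
  have "negligible {z :: real \<times> real. z \<bullet> (0, 1) = 0}"
    by (rule negligible_standard_hyperplane) (simp add: Basis_prod_def)
  then have AE: "AE z :: real \<times> real in lebesgue. snd z \<noteq> 0"
    by (simp add: negligible_iff_null_sets AE_iff_null_sets[symmetric] eventually_ae_filter)
      (auto simp: inner_prod_def)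
  have le: "(cmod (f z))\<^sup>2 \<le> g z" if "z \<in> ?Q" "snd z \<noteq> 0" for z
  proof -
    have P: "pdist z > 0" using pdist_pos Q(3)[OF that(1)] .
    have "(snd z)\<^sup>2 \<le> M\<^sup>2" using Q(2)[OF that(1)] by (simp add: abs_le_square_iff[symmetric] abs_le_iff)
    then have PM: "pdist z \<le> M\<^sup>2 + M" using Q(1)[OF that(1)] by (auto simp: pdist_def)
    have "(cmod (f z))\<^sup>2 \<le> (c * (pdist z + 1) / sqrt (pdist z))\<^sup>2"
      using bd[OF Q(3)[OF that(1)]] by (intro power_mono) auto
    also have "\<dots> = c\<^sup>2 * (pdist z + 1)\<^sup>2 * (1 / pdist z)"
      using P by (simp add: power_mult_distrib power_divide)
    also have "\<dots> \<le> C * (\<bar>fst z\<bar> powr (-3/4) * \<bar>snd z\<bar> powr (-1/2))"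
    proof (rule mult_mono)
      show "c\<^sup>2 * (pdist z + 1)\<^sup>2 \<le> C"
      unfolding C_def using P PM by (intro mult_left_mono power_mono) auto
    qed (use P inverse_pdist_le[OF Q(3)[OF that(1)] that(2)] in \<open>auto simp: C_def\<close>)
    also have "\<dots> = g z" using Q[OF that(1)] by (simp add: g_def)
    finally show ?thesis .
  qed
  have "(\<lambda>z. indicator ?Q z *\<^sub>R f z) \<in> borel_measurable borel"
    using f by measurable
  then have m: "(\<lambda>z. indicator ?Q z *\<^sub>R f z) \<in> borel_measurable lebesgue"
    by (simp add: measurable_completion)
  have "(\<lambda>z. indicator ?Q z *\<^sub>R (cmod (f z))\<^sup>2) \<in> borel_measurable borel"
    using f by measurable
  then have m2: "(\<lambda>z. indicator ?Q z *\<^sub>R (cmod (f z))\<^sup>2) \<in> borel_measurable lebesgue"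
    by (simp add: measurable_completion)
  have "integrable lebesgue (\<lambda>z. indicator ?Q z *\<^sub>R (cmod (f z))\<^sup>2)"
  proof (rule Bochner_Integration.integrable_bound[OF g m2])
    show "AE z in lebesgue. norm (indicator ?Q z *\<^sub>R (cmod (f z))\<^sup>2) \<le> norm (g z)"
      using AE
    proof eventually_elim
      case (elim z)
      then show ?case using le[of z] by (auto simp: indicator_def)
    qed
  qed
  then show ?thesis using m by (simp add: L2_on_def set_borel_measurable_def set_integrable_def)
qed


section \<open>Square integrability of the solution and its x-derivative\<close>

lemma profile_bound:
  assumes "continuous_on UNIV f"
  obtains c where "\<And>z. z \<in> past_halfplane \<Longrightarrow> cmod (f (complex_of_real (simvar z))) \<le> c" "c \<ge> 0"
proof -
  have "compact ((\<lambda>s. f (complex_of_real s)) ` {0..1})"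
    by (intro compact_continuous_image continuous_on_compose2[OF assms] continuous_intros) auto
  then obtain c where "\<And>s. s \<in> {0..1} \<Longrightarrow> cmod (f (complex_of_real s)) \<le> c" "c > 0"
    using compact_imp_bounded bounded_pos by (metis (no_types, lifting) image_eqI)
  with that[of c] show ?thesis using simvar_bounds by auto
qed

text \<open>With m = sqrt P the required bound is a multiple of m + 1/m. It dominates |ln m|, by ln
  y <= y - 1 at y = m and y = 1/m, and it is at least 1, which absorbs the bounded
  corrector.\<close>

lemma L2_on_sol:
  assumes "parabolic_cylinder r w \<subseteq> past_halfplane" "r > 0"
  shows "L2_on (parabolic_cylinder r w) sol"
proof -
  have "continuous_on UNIV corrector" by (intro continuous_intros)
  then obtain c where c: "\<And>z. z \<in> past_halfplane \<Longrightarrow> cmod (corrector (simvar z)) \<le> c" "c \<ge> 0"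
    using profile_bound by blast
  show ?thesis
  proof (rule L2_on_parabolic_cylinder[OF assms borel_measurable_sol, where c = "2 + c"])
    fix z assume z: "z \<in> past_halfplane"
    define m where "m = sqrt (pdist z)"
    have m: "m > 0" "pdist z = m\<^sup>2" using pdist_pos[OF z] by (auto simp: m_def)
    have "\<bar>ln m\<bar> \<le> m + 1 / m"
      using ln_le_minus_one[of m] ln_le_minus_one[of "1 / m"] m by (auto simp: ln_div abs_le_iff) (smt (verit) divide_pos_pos)+
    then have "\<bar>ln (pdist z)\<bar> \<le> 2 * (m + 1 / m)" using m by (simp add: ln_realpow abs_mult)
    moreover have "cmod (sol z) \<le> \<bar>ln (pdist z)\<bar> + cmod (corrector (simvar z))"
      unfolding sol_def by (rule order_trans[OF norm_triangle_ineq]) simp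
    ultimately have "cmod (sol z) \<le> 2 * (m + 1 / m) + c" using c(1)[OF z] by simp
    also have "\<dots> \<le> 2 * (m + 1 / m) + c * (m + 1 / m)"
    proof -
      have "m + 1 / m \<ge> 1" using m zero_le_power2[of "m - 1"] by (simp add: field_simps power2_eq_square)
      then show ?thesis using c(2) mult_left_mono[of 1 "m + 1 / m" c] by simp
    qed
    also have "\<dots> = (2 + c) * (pdist z + 1) / sqrt (pdist z)"
      using m(1) unfolding m_def[symmetric] m(2) by (simp add: field_simps power2_eq_square)
    finally show "cmod (sol z) \<le> (2 + c) * (pdist z + 1) / sqrt (pdist z)" .
  qed
qed

text \<open>Since |x| <= sqrt P, the derivative is at most a constant over sqrt P.\<close>

lemma L2_on_sol_x:
  assumes "parabolic_cylinder r w \<subseteq> past_halfplane" "r > 0"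
  shows "L2_on (parabolic_cylinder r w) sol_x"
proof -
  have "continuous_on UNIV slope_profile" by (intro continuous_intros)
  then obtain c where c: "\<And>z. z \<in> past_halfplane \<Longrightarrow> cmod (slope_profile (simvar z)) \<le> c" "c \<ge> 0"
    using profile_bound by blast
  show ?thesis
  proof (rule L2_on_parabolic_cylinder[OF assms borel_measurable_sol_x, where c = "2 * c"])
    fix z assume z: "z \<in> past_halfplane"
    define m where "m = sqrt (pdist z)"
    have m: "m > 0" "pdist z = m\<^sup>2" using pdist_pos[OF z] by (auto simp: m_def)
    have "\<bar>snd z\<bar> \<le> m"
      unfolding m_def using z by (intro real_le_rsqrt) (auto simp: pdist_def past_halfplane_def)
    then have "cmod (sol_x z) \<le> 2 * m / m\<^sup>2 * c"
      unfolding sol_x_def norm_mult m(2) using c(1)[OF z] m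
      by (intro mult_mono) (auto simp: norm_divide norm_mult norm_power intro!: divide_right_mono)
    also have "\<dots> = 2 * c * 1 / m" using m by (simp add: power2_eq_square)
    also have "\<dots> \<le> 2 * c * (pdist z + 1) / m"
      using m c(2) by (intro divide_right_mono mult_left_mono) auto
    finally show "cmod (sol_x z) \<le> 2 * c * (pdist z + 1) / sqrt (pdist z)" by (simp add: m_def)
  qed
qed

section \<open>The counterexample\<close>

text \<open>The coefficient is a continuous function of the similarity variable on the compact
  interval [0, 1], so it is bounded and its real part attains a minimum, which is positive by the
  sign lemma.\<close>

lemma coeff_range:
  shows "bounded (coeff ` past_halfplane)"
    and "\<exists>c>0. \<forall>z\<in>past_halfplane. c \<le> Re (coeff z)"
proof -
  define k where "k s = - flux_profile (of_real s) / (2 * slope_profile (of_real s))" for s :: real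
  have cont: "continuous_on {0..1} k"
    unfolding k_def using slope_profile_nonzero by (intro continuous_intros) auto
  have sim01: "simvar z \<in> {0..1}" and k: "coeff z = k (simvar z)" if "z \<in> past_halfplane" for z
    using simvar_bounds[OF that] by (auto simp: k_def coeff_def)
  have "bounded (k ` {0..1})"
    using cont by (intro compact_imp_bounded compact_continuous_image) auto
  then show "bounded (coeff ` past_halfplane)"
    by (rule bounded_subset) (use sim01 k in auto)
  have "continuous_on {0..1} (\<lambda>s. Re (k s))"
    using cont by (intro continuous_intros)
  then obtain s0 where s0: "s0 \<in> {0..1}" "\<And>s. s \<in> {0..1} \<Longrightarrow> Re (k s0) \<le> Re (k s)"
    using continuous_attains_inf[of "{0..1}" "\<lambda>s. Re (k s)"] by auto
  have "Re (k s0) > 0"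
  proof -
    have "k s0 = of_real (- 1 / (2 * (cmod (slope_profile s0))\<^sup>2)) * (flux_profile s0 * cnj (slope_profile s0))"
      unfolding k_def by (simp add: complex_div_cnj[of "flux_profile s0"])
    then have "Re (k s0) = - (Re (flux_profile s0 * cnj (slope_profile s0)) / (2 * (cmod (slope_profile s0))\<^sup>2))"
      by simp
    moreover have "Re (flux_profile s0 * cnj (slope_profile s0)) / (2 * (cmod (slope_profile s0))\<^sup>2) < 0"
      using Re_flux_profile_cnj_slope_profile_neg[of s0] slope_profile_nonzero[of s0] s0(1) by (intro divide_neg_pos) auto
    ultimately show ?thesis by linarith
  qed
  then show "\<exists>c>0. \<forall>z\<in>past_halfplane. c \<le> Re (coeff z)"
    using s0(2) sim01 k by auto
qed

lemma coeff_mult_sol_x: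
  assumes "z \<in> past_halfplane"
  shows "coeff z * sol_x z = flux z"
  using slope_profile_nonzero[OF simvar_bounds[OF assms]] by (simp add: coeff_def sol_x_def flux_def)

text \<open>By continuity the part of the cylinder where |u| exceeds a given C is open; being
  nonempty, it cannot be a null set.\<close>

lemma sol_not_essentially_bounded: "\<not> essentially_bounded_on (parabolic_cylinder 1 (0, 0)) sol"
proof
  assume "essentially_bounded_on (parabolic_cylinder 1 (0, 0)) sol"
  then obtain C where C: "AE z in lebesgue. z \<in> parabolic_cylinder 1 (0, 0) \<longrightarrow> cmod (sol z) \<le> C"
    by (auto simp: essentially_bounded_on_def)
  define V where "V = parabolic_cylinder 1 (0, 0) \<inter> sol -` {w. C < cmod w}"
  have sub: "parabolic_cylinder 1 (0, 0) \<subseteq> past_halfplane"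
    by (auto simp: parabolic_cylinder_def past_halfplane_def)
  have "open V" unfolding V_def
  proof (rule continuous_open_preimage)
    show "continuous_on (parabolic_cylinder 1 (0, 0)) sol"
      using continuous_on_sol sub continuous_on_subset by blast
  qed (auto simp: parabolic_cylinder_def open_Times intro!: open_Collect_less continuous_intros)
  \<comment> \<open>On the axis x = 0 the corrector vanishes and u = -ln(-t), so this time gives the
    value |C| + 1; it lies in (-1, 0).\<close>
  moreover have "(- exp (- (\<bar>C\<bar> + 1)), 0) \<in> V"
  proof -
    have "sol (- exp (- (\<bar>C\<bar> + 1)), 0) = of_real (\<bar>C\<bar> + 1)"
      by (simp add: sol_def pdist_def simvar_def corrector_def)
    moreover have "C < cmod (of_real (\<bar>C\<bar> + 1))"
      by (subst norm_of_real) simp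
    ultimately have "C < cmod (sol (- exp (- (\<bar>C\<bar> + 1)), 0))" by (simp only:)
    then show ?thesis by (simp add: V_def parabolic_cylinder_def)
  qed
  moreover have "negligible V"
  proof -
    obtain N where "N \<in> null_sets lebesgue"
      "{z. \<not> (z \<in> parabolic_cylinder 1 (0, 0) \<longrightarrow> cmod (sol z) \<le> C)} \<subseteq> N"
      using C unfolding eventually_ae_filter by auto
    moreover from this(2) have "V \<subseteq> N" by (auto simp: V_def)
    ultimately show ?thesis using negligible_iff_null_sets negligible_subset by blast
  qed
  ultimately show False using open_not_negligible by blast
qed

text \<open>Test functions have compact support in the open half-plane, away from the singularity,
  so the pointwise derivatives are the distributional ones. Both terms of the equation then reduce
  to the pairing with \<open>sol_t\<close>.\<close>

lemma parabolic_solution_sol: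
  assumes sub: "parabolic_cylinder r w \<subseteq> past_halfplane" and r: "r > 0"
  shows "parabolic_solution_on coeff (parabolic_cylinder r w) sol"
proof -
  let ?Q = "parabolic_cylinder r w"
  have Q: "?Q \<in> sets lebesgue"
    by (simp add: parabolic_cylinder_def open_Times lebesgue_openin borel_open)
  note deriv = dist_deriv_dist_of[OF open_past_halfplane sub]
  have x: "dist_deriv e_x (dist_of ?Q sol) \<phi> = dist_of ?Q sol_x \<phi>"
    and t: "dist_deriv e_t (dist_of ?Q sol) \<phi> = dist_of ?Q sol_t \<phi>"
    and fl: "dist_deriv e_x (dist_of ?Q flux) \<phi> = dist_of ?Q sol_t \<phi>"
    if \<phi>: "\<phi> \<in> test_functions ?Q" for \<phi>
  proof -
    show "dist_deriv e_x (dist_of ?Q sol) \<phi> = dist_of ?Q sol_x \<phi>"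
      using deriv[OF has_derivative_sol, of e_x \<phi>] continuous_on_sol_x \<phi> by simp
    show "dist_deriv e_t (dist_of ?Q sol) \<phi> = dist_of ?Q sol_t \<phi>"
      using deriv[OF has_derivative_sol, of e_t \<phi>] continuous_on_sol_t \<phi> by simp
    have "continuous_on past_halfplane (\<lambda>z. frechet_derivative flux (at z) e_x)"
      using continuous_on_sol_t has_derivative_flux(2) by (simp cong: continuous_on_cong)
    from deriv[OF has_derivative_flux(1) this \<phi>]
    have "dist_deriv e_x (dist_of ?Q flux) \<phi> = dist_of ?Q (\<lambda>z. frechet_derivative flux (at z) e_x) \<phi>" .
    also have "\<dots> = dist_of ?Q sol_t \<phi>"
      unfolding dist_of_def using sub has_derivative_flux(2)
      by (intro set_lebesgue_integral_cong[OF Q]) auto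
    finally show "dist_deriv e_x (dist_of ?Q flux) \<phi> = dist_of ?Q sol_t \<phi>" .
  qed
  have eq: "dist_of ?Q (\<lambda>z. coeff z * sol_x z) = dist_of ?Q flux"
    unfolding dist_of_def using sub coeff_mult_sol_x
    by (intro ext set_lebesgue_integral_cong[OF Q]) auto
  show ?thesis unfolding parabolic_solution_on_def
  proof (intro conjI exI[of _ sol_x] ballI)
    show "L2_on ?Q sol" "L2_on ?Q sol_x" using assms by (rule L2_on_sol, rule L2_on_sol_x)
  qed (simp_all only: x t fl eq diff_self)
qed

theorem theorem1p3:
  shows "\<exists>(a :: real \<times> real \<Rightarrow> complex) (u :: real \<times> real \<Rightarrow> complex).
    bounded (a ` past_halfplane) \<and>
    set_borel_measurable lebesgue past_halfplane a \<and>
    strictly_accretive_on past_halfplane a \<and>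
    parabolic_solution_past a u \<and>
    \<not> essentially_bounded_on (parabolic_cylinder 1 (0, 0)) u"
proof (rule exI[of _ coeff], rule exI[of _ sol], intro conjI)
  show "bounded (coeff ` past_halfplane)" by (rule coeff_range)
  have "past_halfplane \<in> sets borel" by (intro borel_open open_past_halfplane)
  then have "(\<lambda>z. indicator past_halfplane z *\<^sub>R coeff z) \<in> borel_measurable borel"
    using borel_measurable_coeff by measurable
  then show "set_borel_measurable lebesgue past_halfplane coeff"
    by (simp add: set_borel_measurable_def measurable_completion)
  show "strictly_accretive_on past_halfplane coeff"
    using coeff_range(2) by (auto simp: strictly_accretive_on_def)
  show "parabolic_solution_past coeff sol"
    using parabolic_solution_sol by (simp add: parabolic_solution_past_def)
  show "\<not> essentially_bounded_on (parabolic_cylinder 1 (0, 0)) sol"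
    by (rule sol_not_essentially_bounded)
qed

end
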